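(* Suppose that $U^-\ge 0$ at every boundary node and that, for real numbers $\overline{\lambda}$, $\Delta t\ge 0$ and $\overline{W}>0$: (i) $\overline{h}\le\overline{\lambda}\,U^-$ at every boundary node (numerical flux is bounded via the speed cap $\overline\lambda$); (ii) $\overline{\lambda}\,\Delta t\le\overline{W}$; (iii) $\overline{W}\;\overline{\mathcal B}U\le\overline{\mathcal C}U$ (the boundary crowding $\overline{\mathcal B}U/\overline{\mathcal C}U$ is capped by $\overline M=\overline W^{-1}$). Then the updated cell average $\overline{\mathcal C}U-\Delta t\,\overline{\mathcal B}\,\overline{h}$ is nonnegative.
   Context: $K\subset\mathbb R^D$ is a mesh cell with volume $V$ and boundary area $A$; $U$ is a real-valued function (polynomial representation of the solution) in $K$. $\overline{\mathcal C}U:=\frac1V\int_K U$ is the cell average. The boundary nodes are finitely many points $\mathbf x\in Q\subset\partial K$ carrying quadrature weights $\omega_{\mathbf x}>0$, and for a function $g$ on the nodes $\overline{\mathcal B}g:=\frac1A\sum_{\mathbf x\in Q}\omega_{\mathbf x}g(\mathbf x)$ is the boundary average quadrature; $\overline{\mathcal B}U$ means $\overline{\mathcal B}U^-$, where $U^-(\mathbf x)$ is the value of $U$ at the node approached from within $K$. $h(\mathbf x)$ is the outward numerical flux at the node and $\overline h:=\frac{A}{V}h$. An explicit Euler step of a conservative finite volume method updates the cell average by $\overline{\mathcal C}U\mapsto\overline{\mathcal C}U-\Delta t\,\overline{\mathcal B}\,\overline h$. The speed cap $\overline\lambda$ is uniform over all boundary nodes. *)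

theory Defs
  imports "HOL-Analysis.Analysis"
begin

text \<open>The Hausdorff measure in integer dimension \<open>k\<close>, normalised so that on a smooth
  \<open>k\<close>-dimensional surface it is the surface area.  The empty set gets gauge 0 separately because
  \<open>0 ^ 0 = 1\<close>; for \<open>k = 0\<close> the result is counting measure.\<close>

definition hausdorff_gauge :: "nat \<Rightarrow> 'a::metric_space set \<Rightarrow> ennreal" where
  "hausdorff_gauge k S =
     (if S = {} then 0 else ennreal (unit_ball_vol (real k) * (diameter S / 2) ^ k))"

text \<open>The sets of a cover are required to be bounded because \<open>diameter\<close> is unspecified on
  unbounded sets.\<close>

definition hausdorff_pre :: "nat \<Rightarrow> real \<Rightarrow> 'a::metric_space set \<Rightarrow> ennreal" where
  "hausdorff_pre k \<delta> S =
     (INF C \<in> {C :: nat \<Rightarrow> 'a set. S \<subseteq> (\<Union>i. C i) \<and> (\<forall>i. bounded (C i) \<and> diameter (C i) \<le> \<delta>)}.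
        \<Sum>i. hausdorff_gauge k (C i))"

definition hausdorff_measure :: "nat \<Rightarrow> 'a::metric_space set \<Rightarrow> ennreal" where
  "hausdorff_measure k S = (SUP \<delta>\<in>{0<..}. hausdorff_pre k \<delta> S)"

definition cell_volume :: "(real ^ 'd) set \<Rightarrow> real" where
  "cell_volume K = measure lebesgue K"

definition boundary_area :: "(real ^ 'd) set \<Rightarrow> real" where
  "boundary_area K = enn2real (hausdorff_measure (CARD('d) - 1) (frontier K))"

text \<open>No particular shape (simplex, box, polytope) is imposed on a mesh cell.  The condition on the
  frontier says that each boundary point can be approached from the interior, so that values
  ``approached from within the cell'' make sense.\<close>

definition mesh_cell :: "(real ^ 'd) set \<Rightarrow> bool" where
  "mesh_cell K \<longleftrightarrow>
     bounded K \<and> K \<in> sets lebesgue \<and> interior K \<noteq> {} \<and> frontier K \<subseteq> closure (interior K) \<and>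
     0 < hausdorff_measure (CARD('d) - 1) (frontier K) \<and>
     hausdorff_measure (CARD('d) - 1) (frontier K) < \<infinity>"

definition cell_average :: "(real ^ 'd) set \<Rightarrow> (real ^ 'd \<Rightarrow> real) \<Rightarrow> real" where
  "cell_average K U = 1 / cell_volume K * (LINT x:K|lebesgue. U x)"

text \<open>The interior trace \<open>U\<^sup>-\<close>; it is meaningful at the points where \<open>has_inner_trace\<close> holds.\<close>

definition has_inner_trace :: "(real ^ 'd) set \<Rightarrow> (real ^ 'd \<Rightarrow> real) \<Rightarrow> real ^ 'd \<Rightarrow> bool" where
  "has_inner_trace K U x \<longleftrightarrow> (\<exists>l. (U \<longlongrightarrow> l) (at x within interior K))"

definition inner_trace :: "(real ^ 'd) set \<Rightarrow> (real ^ 'd \<Rightarrow> real) \<Rightarrow> real ^ 'd \<Rightarrow> real" where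
  "inner_trace K U x = Lim (at x within interior K) U"

definition boundary_average ::
    "(real ^ 'd) set \<Rightarrow> (real ^ 'd) set \<Rightarrow> (real ^ 'd \<Rightarrow> real) \<Rightarrow> (real ^ 'd \<Rightarrow> real) \<Rightarrow> real" where
  "boundary_average K Q \<omega> g = 1 / boundary_area K * (\<Sum>x\<in>Q. \<omega> x * g x)"

definition scaled_flux :: "(real ^ 'd) set \<Rightarrow> (real ^ 'd \<Rightarrow> real) \<Rightarrow> real ^ 'd \<Rightarrow> real" where
  "scaled_flux K h x = boundary_area K / cell_volume K * h x"

definition euler_cell_average ::
    "(real ^ 'd) set \<Rightarrow> (real ^ 'd) set \<Rightarrow> (real ^ 'd \<Rightarrow> real) \<Rightarrow> (real ^ 'd \<Rightarrow> real) \<Rightarrow>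
     (real ^ 'd \<Rightarrow> real) \<Rightarrow> real \<Rightarrow> real" where
  "euler_cell_average K Q \<omega> U h \<Delta>t =
     cell_average K U - \<Delta>t * boundary_average K Q \<omega> (scaled_flux K h)"

text \<open>Polynomials are integrable on a mesh cell and their inner trace is the point value.\<close>

lemma inner_trace_unique:
  assumes "mesh_cell K" "x \<in> frontier K" "(U \<longlongrightarrow> l) (at x within interior K)"
  shows "inner_trace K U x = l"
proof -
  have "x \<in> closure (interior K)" "x \<notin> interior K"
    using assms(1,2) by (auto simp: mesh_cell_def frontier_def)
  then have "at x within interior K \<noteq> bot"
    by (metis closure_def Un_iff mem_Collect_eq trivial_limit_within)
  then show ?thesis
    unfolding inner_trace_def using assms(3) by (rule tendsto_Lim)
qed

lemma polynomial_has_inner_trace: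
  assumes "mesh_cell K" "real_polynomial_function U" "x \<in> frontier K"
  shows "has_inner_trace K U x" "inner_trace K U x = U x"
proof -
  have *: "(U \<longlongrightarrow> U x) (at x within interior K)"
    using assms(2) by (meson continuous_real_polymonial_function isCont_def tendsto_within_subset subset_UNIV)
  show "has_inner_trace K U x" using * by (auto simp: has_inner_trace_def)
  show "inner_trace K U x = U x" using inner_trace_unique[OF assms(1,3) *] .
qed

lemma polynomial_set_integrable:
  assumes "mesh_cell K" "real_polynomial_function U"
  shows "set_integrable lebesgue K U"
proof -
  have "compact (closure K)" using assms(1) by (auto simp: mesh_cell_def)
  moreover have "continuous_on (closure K) U"
    using assms(2) continuous_real_polymonial_function continuous_at_imp_continuous_on by blast
  ultimately have "set_integrable lborel (closure K) U"
    unfolding set_integrable_def by (rule borel_integrable_compact)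
  then have "set_integrable lebesgue (closure K) U"
    unfolding set_integrable_def by (simp add: integrable_completion borel_measurable_integrable)
  then show ?thesis
    by (rule set_integrable_subset) (use assms(1) closure_subset in \<open>auto simp: mesh_cell_def\<close>)
qed

end

theory Submission
  imports Defs
begin

text \<open>The boundary average is a positive linear functional on node values, because the weights and
  the boundary area are nonnegative.  Applied to the pointwise flux cap it therefore bounds the
  averaged outflux by \<open>lam\<close> times the boundary average of the traces.  That average is nonnegative,
  so the time step restriction may be multiplied by it: the amount leaving during one step is
  at most \<open>W\<close> times the boundary average, which the crowding cap bounds by the current cell
  average.  Altogether, with \<open>B\<close> and \<open>C\<close> the two averages,
  \<open>\<Delta>t * B(flux) \<le> \<Delta>t * lam * B(U) \<le> W * B(U) \<le> C(U)\<close>.\<close>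

lemma boundary_average_mono:
  assumes "\<And>x. x \<in> Q \<Longrightarrow> 0 \<le> \<omega> x" "\<And>x. x \<in> Q \<Longrightarrow> f x \<le> g x"
  shows "boundary_average K Q \<omega> f \<le> boundary_average K Q \<omega> g"
  unfolding boundary_average_def
  by (intro mult_left_mono sum_mono) (auto simp: assms boundary_area_def)

lemma boundary_average_nonneg:
  assumes "\<And>x. x \<in> Q \<Longrightarrow> 0 \<le> \<omega> x" "\<And>x. x \<in> Q \<Longrightarrow> 0 \<le> g x"
  shows "0 \<le> boundary_average K Q \<omega> g"
  using boundary_average_mono[of Q \<omega> "\<lambda>_. 0" g K] assms by (simp add: boundary_average_def)

lemma boundary_average_scale:
  "boundary_average K Q \<omega> (\<lambda>x. c * g x) = c * boundary_average K Q \<omega> g"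
  by (simp add: boundary_average_def sum_distrib_left mult_ac)

theorem theorem3p12:
  fixes K Q :: "(real ^ 'd) set"
    and U h \<omega> :: "real ^ 'd \<Rightarrow> real"
    and lam \<Delta>t W :: real
  assumes cell: "mesh_cell K"
    and U_integrable: "set_integrable lebesgue K U"
    and nodes: "finite Q" "Q \<subseteq> frontier K"
    and weights: "\<And>x. x \<in> Q \<Longrightarrow> 0 < \<omega> x"
    and traces: "\<And>x. x \<in> Q \<Longrightarrow> has_inner_trace K U x"
    and U_nonneg: "\<And>x. x \<in> Q \<Longrightarrow> 0 \<le> inner_trace K U x"
    and dt: "0 \<le> \<Delta>t"
    and W: "0 < W"
    and flux_cap: "\<And>x. x \<in> Q \<Longrightarrow> scaled_flux K h x \<le> lam * inner_trace K U x"
    and cfl: "lam * \<Delta>t \<le> W"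
    and crowding: "W * boundary_average K Q \<omega> (inner_trace K U) \<le> cell_average K U"
  shows "0 \<le> euler_cell_average K Q \<omega> U h \<Delta>t"
proof -
  let ?B = "boundary_average K Q \<omega>"
  have \<omega>_nonneg: "\<And>x. x \<in> Q \<Longrightarrow> 0 \<le> \<omega> x"
    using weights by (simp add: less_imp_le)
  have "?B (scaled_flux K h) \<le> ?B (\<lambda>x. lam * inner_trace K U x)"
    using \<omega>_nonneg flux_cap by (rule boundary_average_mono)
  then have "\<Delta>t * ?B (scaled_flux K h) \<le> \<Delta>t * (lam * ?B (inner_trace K U))"
    unfolding boundary_average_scale using dt by (rule mult_left_mono)
  also have "\<dots> = (lam * \<Delta>t) * ?B (inner_trace K U)"
    by (simp add: mult_ac)
  also have "\<dots> \<le> W * ?B (inner_trace K U)"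
    using cfl boundary_average_nonneg[OF \<omega>_nonneg U_nonneg] by (rule mult_right_mono)
  also note crowding
  finally show ?thesis
    by (simp add: euler_cell_average_def)
qed

end
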